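(* Let $f\in\mathbb{R}[\mathbf{x}]$ and let $2d\geq \deg f$. The best $\ell_1$-norm approximation of $f$ by a sum of squares (s.o.s.) polynomial of degree at most $2d$ is given by $$\mathbf{x}\,\mapsto\, g(\mathbf{x})\,=\,f(\mathbf{x})+\Big(\lambda^*_0+\sum_{i=1}^n \lambda^*_i\,x_i^{2d}\Big),$$ for some nonnegative vector $\lambda^*=(\lambda^*_0,\ldots,\lambda^*_n)\in\mathbb{R}^{n+1}$. Hence $\rho_d=\sum_{i=0}^n\lambda^*_i$, and in addition, $\lambda^*$ is an optimal solution of the semidefinite program $$\min_{\lambda\geq0}\ \left\{\sum_{i=0}^n\lambda_i\;:\; f+\lambda_0+\sum_{i=1}^n\lambda_i\,x_i^{2d}\in\Sigma[\mathbf{x}]_d\right\}.$$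
   Context: $\mathbb{R}[\mathbf{x}]$ is the ring of real polynomials in the variables $\mathbf{x}=(x_1,\ldots,x_n)$, and $d\in\mathbb{N}$. $\Sigma[\mathbf{x}]_d\subset\mathbb{R}[\mathbf{x}]$ denotes the set of polynomials of degree at most $2d$ that are sums of squares (s.o.s.) of real polynomials. For $f=\sum_{\alpha\in\mathbb{N}^n} f_\alpha\,\mathbf{x}^\alpha$, where $\mathbf{x}^\alpha=x_1^{\alpha_1}\cdots x_n^{\alpha_n}$, $\Vert f\Vert_1:=\sum_\alpha|f_\alpha|$ is the $\ell_1$-norm of the coefficient vector of $f$. The problem of best $\ell_1$-norm approximation of $f$ by a s.o.s. polynomial of degree at most $2d$ is the optimization problem $$\rho_d:=\min_g\,\{\,\Vert f-g\Vert_1\;:\; g\in\Sigma[\mathbf{x}]_d\,\},$$ whose optimal value is denoted $\rho_d$. In the semidefinite program, $\lambda=(\lambda_0,\ldots,\lambda_n)$ ranges over $\mathbb{R}^{n+1}$ and $\lambda\geq0$ is understood componentwise. *)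

theory Defs
  imports Complex_Main "HOL-Library.Poly_Mapping"
begin

text \<open>
  Real polynomials are finitely supported maps from monomials to coefficients, a monomial being a
  finitely supported map from variable indices to exponents.  The ring operations of
  \<^theory>\<open>HOL-Library.Poly_Mapping\<close> (convolution product) are those of polynomials.  The type has
  infinitely many variables; \<open>polys n\<close> is the ring in the variables with indices \<open>1, \<dots>, n\<close>.
\<close>

type_synonym real_mpoly = "(nat \<Rightarrow>\<^sub>0 nat) \<Rightarrow>\<^sub>0 real"

definition polys :: "nat \<Rightarrow> real_mpoly set" where
  "polys n = {p. \<forall>m \<in> Poly_Mapping.keys p. Poly_Mapping.keys m \<subseteq> {1..n}}"

definition cst :: "real \<Rightarrow> real_mpoly" where
  "cst c = Poly_Mapping.single 0 c"

definition var :: "nat \<Rightarrow> real_mpoly" where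
  "var i = Poly_Mapping.single (Poly_Mapping.single i 1) 1"

definition monom_deg :: "(nat \<Rightarrow>\<^sub>0 nat) \<Rightarrow> nat" where
  "monom_deg m = (\<Sum>i \<in> Poly_Mapping.keys m. Poly_Mapping.lookup m i)"

text \<open>The zero polynomial has degree \<open>0\<close>, so it satisfies every degree bound.\<close>

definition total_deg :: "real_mpoly \<Rightarrow> nat" where
  "total_deg p = Max (insert 0 (monom_deg ` Poly_Mapping.keys p))"

definition l1_norm :: "real_mpoly \<Rightarrow> real" where
  "l1_norm p = (\<Sum>m \<in> Poly_Mapping.keys p. \<bar>Poly_Mapping.lookup p m\<bar>)"

text \<open>The degree bound is on the sum, not on the polynomials that are squared.\<close>

definition sos :: "nat \<Rightarrow> nat \<Rightarrow> real_mpoly set" where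
  "sos n d = {g \<in> polys n. total_deg g \<le> 2 * d \<and>
     (\<exists>qs. set qs \<subseteq> polys n \<and> g = (\<Sum>q\<leftarrow>qs. q ^ 2))}"

text \<open>
  The optimal value is an infimum here; that it is attained is expressed separately, by
  \<^const>\<open>is_arg_min\<close>.
\<close>

definition rho :: "nat \<Rightarrow> nat \<Rightarrow> real_mpoly \<Rightarrow> real" where
  "rho n d f = (INF g \<in> sos n d. l1_norm (f - g))"

text \<open>Only the components \<open>l 0, \<dots>, l n\<close> of \<open>l\<close> matter: \<open>l\<close> encodes a vector with \<open>n + 1\<close> entries.\<close>

definition perturb :: "nat \<Rightarrow> nat \<Rightarrow> real_mpoly \<Rightarrow> (nat \<Rightarrow> real) \<Rightarrow> real_mpoly" where
  "perturb n d f l = f + (cst (l 0) + (\<Sum>i = 1..n. cst (l i) * var i ^ (2 * d)))"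

end

theory Submission
  imports Defs
begin

text \<open>
  Moving \<open>f\<close> to \<open>f + \<lambda>\<^sub>0 + \<Sum>\<^sub>i \<lambda>\<^sub>i x\<^sub>i ^ (2 d)\<close> with \<open>\<lambda> \<ge> 0\<close> changes it by at most \<open>\<Sum>\<^sub>i \<lambda>\<^sub>i\<close> in the
  \<open>l\<^sub>1\<close>-norm. So the theorem follows from two facts: any approximation \<open>g\<close> of \<open>f\<close> by a sum of squares
  can be replaced by a perturbation of this form with \<open>\<Sum>\<^sub>i \<lambda>\<^sub>i \<le> \<parallel>f - g\<parallel>\<^sub>1\<close>, and among the feasible
  perturbations there is one of least total weight. Its weight is then a lower bound for every
  \<open>\<parallel>f - g\<parallel>\<^sub>1\<close> and an upper bound for its own distance to \<open>f\<close>.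

  The first fact is proved directly on the side of sums of squares, without duality for semidefinite
  programs. As \<open>f = g + (f - g)\<close>, it suffices to treat a single term \<open>c m\<close> of \<open>f - g\<close>: it becomes a
  sum of squares after adding a combination of \<open>1, x\<^sub>1 ^ (2 d), \<dots>, x\<^sub>n ^ (2 d)\<close> with nonnegative
  weights of sum at most \<open>\<bar>c\<bar>\<close> (\<open>liftable_single\<close>).
  Splitting \<open>m = u v\<close> into factors of degree at most \<open>d\<close> and completing the square reduces this to \<open>- u\<^sup>2\<close>, which is the inequality of arithmetic and geometric means with a
  sum of squares as certificate (\<open>liftable_neg_even_monomial\<close>). The certificate comes from the
  convexity of the sequence of monomials obtained by moving exponents from one variable to another.

  The second fact needs the cone of sums of squares to be closed (\<open>sos_closed\<close>). Rotations bound the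
  number of squares by the number of monomials (\<open>sum_of_card_many_squares\<close>), and the leading
  parts of squares cannot cancel (\<open>extreme_monomial_sum_squares\<close>), which bounds the degrees and the
  coefficients of the polynomials that are squared. A compactness argument completes the proof.
\<close>

section \<open>Monomials and polynomials of bounded degree\<close>

definition monoms :: "nat \<Rightarrow> nat \<Rightarrow> (nat \<Rightarrow>\<^sub>0 nat) set" where
  "monoms n D = {m. Poly_Mapping.keys m \<subseteq> {1..n} \<and> monom_deg m \<le> D}"

definition polys_le :: "nat \<Rightarrow> nat \<Rightarrow> real_mpoly set" where
  "polys_le n D = {p. Poly_Mapping.keys p \<subseteq> monoms n D}"

lemma monom_deg_superset:
  assumes "finite A" "Poly_Mapping.keys m \<subseteq> A"
  shows "monom_deg m = (\<Sum>i\<in>A. Poly_Mapping.lookup m i)"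
  unfolding monom_deg_def
  by (rule sum.mono_neutral_left) (use assms in \<open>auto simp: in_keys_iff\<close>)

lemma monom_deg_add: "monom_deg (a + b) = monom_deg a + monom_deg b"
proof -
  let ?A = "Poly_Mapping.keys a \<union> Poly_Mapping.keys b"
  have "Poly_Mapping.keys (a + b) \<subseteq> ?A" by (rule keys_add)
  then show ?thesis
    by (simp add: monom_deg_superset[of ?A] lookup_add sum.distrib)
qed

lemma monom_deg_0 [simp]: "monom_deg 0 = 0"
  by (simp add: monom_deg_def)

lemma monom_deg_single [simp]: "monom_deg (Poly_Mapping.single i k) = k"
  by (cases "k = 0") (simp_all add: monom_deg_def)

lemma finite_monoms [simp]: "finite (monoms n D)"
proof -
  let ?F = "{g. \<forall>x. (x \<in> {1..n} \<longrightarrow> g x \<in> {0..D}) \<and> (x \<notin> {1..n} \<longrightarrow> g x = 0)}"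
  have "Poly_Mapping.lookup m i \<le> D" if "m \<in> monoms n D" for m i
    using that member_le_sum[of i "Poly_Mapping.keys m" "Poly_Mapping.lookup m"]
    by (cases "i \<in> Poly_Mapping.keys m") (auto simp: monoms_def monom_deg_def in_keys_iff)
  then have "Poly_Mapping.lookup ` monoms n D \<subseteq> ?F"
    by (auto simp: monoms_def in_keys_iff subset_iff)
  moreover have "finite ?F" by (rule finite_set_of_finite_funs) auto
  ultimately have "finite (Poly_Mapping.lookup ` monoms n D)" by (rule finite_subset)
  moreover have "inj_on Poly_Mapping.lookup (monoms n D)" by (simp add: inj_on_def)
  ultimately show ?thesis by (rule finite_imageD)
qed

lemma monoms_add: "a \<in> monoms n D \<Longrightarrow> b \<in> monoms n E \<Longrightarrow> a + b \<in> monoms n (D + E)"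
  using keys_add[of a b] by (fastforce simp: monoms_def monom_deg_add)

lemma keys_subset_iff:
  "Poly_Mapping.keys p \<subseteq> M \<longleftrightarrow> (\<forall>m. m \<notin> M \<longrightarrow> Poly_Mapping.lookup p m = 0)"
  by (auto simp: in_keys_iff)

lemma polys_le_iff:
  "p \<in> polys_le n D \<longleftrightarrow> p \<in> polys n \<and> total_deg p \<le> D"
  by (auto simp: polys_le_def polys_def total_deg_def monoms_def)

lemma polys_le_add [intro]: "p \<in> polys_le n D \<Longrightarrow> q \<in> polys_le n D \<Longrightarrow> p + q \<in> polys_le n D"
  and polys_le_diff [intro]: "p \<in> polys_le n D \<Longrightarrow> q \<in> polys_le n D \<Longrightarrow> p - q \<in> polys_le n D"
  and polys_le_0 [simp]: "0 \<in> polys_le n D"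
  by (auto simp: polys_le_def keys_subset_iff lookup_add lookup_minus)

lemma polys_le_mult:
  assumes "p \<in> polys_le n D" "q \<in> polys_le n E"
  shows "p * q \<in> polys_le n (D + E)"
  using assms keys_mult[of p q] monoms_add by (fastforce simp: polys_le_def)

lemma polys_le_single: "m \<in> monoms n D \<Longrightarrow> Poly_Mapping.single m c \<in> polys_le n D"
  by (auto simp: polys_le_def split: if_splits)

lemma polys_le_cst [simp]: "cst c \<in> polys_le n D"
  unfolding cst_def by (rule polys_le_single) (simp add: monoms_def)

lemma polys_le_1 [simp]: "1 \<in> polys_le n D"
  using polys_le_cst[of 1 n D] by (simp add: cst_def)

lemma polys_le_var: "i \<in> {1..n} \<Longrightarrow> var i \<in> polys_le n 1"
  unfolding var_def by (rule polys_le_single) (simp add: monoms_def)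

lemma polys_le_power: "p \<in> polys_le n D \<Longrightarrow> p ^ k \<in> polys_le n (k * D)"
  by (induction k) (auto simp: polys_le_mult)

lemma polys_le_prod:
  assumes "finite I" "\<And>i. i \<in> I \<Longrightarrow> p i \<in> polys_le n (D i)"
  shows "(\<Prod>i\<in>I. p i) \<in> polys_le n (\<Sum>i\<in>I. D i)"
  using assms by (induction I) (auto simp: polys_le_mult)

lemma cst_0 [simp]: "cst 0 = 0" and cst_1 [simp]: "cst 1 = 1"
  and cst_add: "cst (a + b) = cst a + cst b" and cst_mult: "cst (a * b) = cst a * cst b"
  by (simp_all add: cst_def single_add mult_single)

lemma cst_of_nat: "cst (of_nat k) = of_nat k"
  by (simp add: cst_def)

lemma lookup_cst_mult [simp]:
  "Poly_Mapping.lookup (cst c * p) m = c * Poly_Mapping.lookup p m"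
proof -
  have "cst c * p = Poly_Mapping.map ((*) c) p"
    by (simp add: cst_def mult_map_scale_conv_mult)
  then show ?thesis by (simp add: Poly_Mapping.map.rep_eq when_def)
qed

lemma polys_le_cst_mult [intro]: "p \<in> polys_le n D \<Longrightarrow> cst c * p \<in> polys_le n D"
  by (simp add: polys_le_def keys_subset_iff)

text \<open>
  The convolution as a double sum over one fixed finite set of monomials: in this form the product is
  visibly a continuous function of the coefficients, and single terms of the sum can be isolated.
\<close>

lemma lookup_mult_finite:
  fixes p q :: real_mpoly
  assumes M: "finite M" "Poly_Mapping.keys p \<subseteq> M" "Poly_Mapping.keys q \<subseteq> M"
  shows "Poly_Mapping.lookup (p * q) c =
    (\<Sum>a\<in>M. \<Sum>b\<in>M. if a + b = c then Poly_Mapping.lookup p a * Poly_Mapping.lookup q b else 0)"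
proof -
  have e: "r = (\<Sum>a\<in>M. Poly_Mapping.single a (Poly_Mapping.lookup r a))"
    if "Poly_Mapping.keys r \<subseteq> M" for r :: real_mpoly
    using that M(1)
    by (intro poly_mapping_eqI) (auto simp: lookup_sum lookup_single when_def in_keys_iff)
  have "p * q = (\<Sum>a\<in>M. \<Sum>b\<in>M. Poly_Mapping.single (a + b)
      (Poly_Mapping.lookup p a * Poly_Mapping.lookup q b))"
    by (subst e[OF M(2)], subst e[OF M(3)]) (simp add: sum_product mult_single)
  then show ?thesis
    by (simp add: lookup_sum lookup_single when_def)
qed

lemma var_power: "var i ^ k = Poly_Mapping.single (Poly_Mapping.single i k) 1"
  by (induction k) (simp_all add: var_def mult_single flip: single_add)

lemma single_eq_prod_var:
  assumes "finite A" "Poly_Mapping.keys m \<subseteq> A"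
  shows "Poly_Mapping.single m 1 = (\<Prod>i\<in>A. var i ^ Poly_Mapping.lookup m i)"
proof -
  have "(\<Prod>i\<in>A. Poly_Mapping.single (Poly_Mapping.single i (f i)) 1)
      = (Poly_Mapping.single (\<Sum>i\<in>A. Poly_Mapping.single i (f i)) 1 :: real_mpoly)"
    for f :: "nat \<Rightarrow> nat"
    using assms(1) by (induction A) (simp_all add: mult_single)
  moreover have "(\<Sum>i\<in>A. Poly_Mapping.single i (Poly_Mapping.lookup m i)) = m"
    using assms by (intro poly_mapping_eqI) (auto simp: lookup_sum lookup_single when_def in_keys_iff)
  ultimately show ?thesis by (simp add: var_power)
qed

lemma monomial_split:
  assumes "m \<in> monoms n (a + b)"
  shows "\<exists>u\<in>monoms n a. \<exists>v\<in>monoms n b. m = u + v"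
  using assms
proof (induction b arbitrary: m)
  case 0
  then show ?case by (intro bexI[of _ m] bexI[of _ 0]) (auto simp: monoms_def)
next
  case (Suc b)
  show ?case
  proof (cases "m = 0")
    case True
    then show ?thesis by (intro bexI[of _ 0]) (auto simp: monoms_def)
  next
    case False
    then obtain i where i: "i \<in> Poly_Mapping.keys m"
      using poly_mapping_eqI[of m 0] by (auto simp: in_keys_iff)
    define m' where "m' = m - Poly_Mapping.single i 1"
    have m: "m = m' + Poly_Mapping.single i 1"
      using i by (intro poly_mapping_eqI)
        (auto simp: m'_def lookup_add lookup_minus lookup_single when_def in_keys_iff)
    have "Poly_Mapping.keys m' \<subseteq> Poly_Mapping.keys m"
      by (auto simp: m in_keys_iff lookup_add)
    then have "m' \<in> monoms n (a + b)"
      using Suc.prems by (auto simp: monoms_def m monom_deg_add)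
    with Suc.IH obtain u v where uv: "u \<in> monoms n a" "v \<in> monoms n b" "m' = u + v" by blast
    have "Poly_Mapping.single i 1 \<in> monoms n 1"
      using i Suc.prems by (auto simp: monoms_def)
    then have "v + Poly_Mapping.single i 1 \<in> monoms n (Suc b)"
      using monoms_add[OF uv(2)] by fastforce
    then show ?thesis using uv by (auto simp: m add.assoc)
  qed
qed

section \<open>The l1-norm of the coefficients\<close>

lemma l1_norm_superset:
  assumes "finite A" "Poly_Mapping.keys p \<subseteq> A"
  shows "l1_norm p = (\<Sum>m\<in>A. \<bar>Poly_Mapping.lookup p m\<bar>)"
  unfolding l1_norm_def
  by (rule sum.mono_neutral_left) (use assms in \<open>auto simp: in_keys_iff\<close>)

lemma l1_norm_add: "l1_norm (p + q) \<le> l1_norm p + l1_norm q"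
proof -
  let ?A = "Poly_Mapping.keys p \<union> Poly_Mapping.keys q"
  have "Poly_Mapping.keys (p + q) \<subseteq> ?A" by (rule keys_add)
  then show ?thesis
    by (simp add: l1_norm_superset[of ?A] lookup_add flip: sum.distrib)
      (intro sum_mono abs_triangle_ineq)
qed

lemma l1_norm_uminus: "l1_norm (- p) = l1_norm p"
  using l1_norm_superset[of "Poly_Mapping.keys p" "- p"]
  by (simp add: l1_norm_def keys_subset_iff in_keys_iff)

lemma l1_norm_single: "l1_norm (Poly_Mapping.single m c) = \<bar>c\<bar>"
  by (simp add: l1_norm_def)

lemma l1_norm_sum: "finite A \<Longrightarrow> l1_norm (\<Sum>a\<in>A. p a) \<le> (\<Sum>a\<in>A. l1_norm (p a))"
proof (induction A rule: finite_induct)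
  case (insert a A)
  then show ?case using l1_norm_add[of "p a" "\<Sum>a\<in>A. p a"] by simp
qed (simp add: l1_norm_def)

section \<open>The cone of sums of squares\<close>

lemma sos_iff:
  "g \<in> sos n d \<longleftrightarrow> g \<in> polys_le n (2 * d) \<and> (\<exists>qs. set qs \<subseteq> polys n \<and> g = (\<Sum>q\<leftarrow>qs. q ^ 2))"
  by (auto simp: sos_def polys_le_iff)

lemma sos_add [intro]:
  assumes "g \<in> sos n d" "h \<in> sos n d"
  shows "g + h \<in> sos n d"
proof -
  obtain ps qs where *: "set ps \<subseteq> polys n" "g = (\<Sum>q\<leftarrow>ps. q ^ 2)"
    "set qs \<subseteq> polys n" "h = (\<Sum>q\<leftarrow>qs. q ^ 2)"
    using assms by (auto simp: sos_iff)
  then have "set (ps @ qs) \<subseteq> polys n" "g + h = (\<Sum>q\<leftarrow>ps @ qs. q ^ 2)" by auto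
  then show ?thesis using assms polys_le_add unfolding sos_iff by blast
qed

lemma sos_0 [simp]: "0 \<in> sos n d"
  unfolding sos_iff by (auto intro: exI[of _ "[]"])

lemma sos_square: "q \<in> polys_le n d \<Longrightarrow> q ^ 2 \<in> sos n d"
  using polys_le_power[of q n d 2] unfolding sos_iff
  by (auto intro!: exI[of _ "[q]"] simp: polys_le_iff)

lemma polys_cst_mult: "p \<in> polys n \<Longrightarrow> cst c * p \<in> polys n"
  by (auto simp: polys_def in_keys_iff)

lemma sos_scale:
  assumes "g \<in> sos n d" "0 \<le> c"
  shows "cst c * g \<in> sos n d"
proof -
  obtain qs where *: "set qs \<subseteq> polys n" "g = (\<Sum>q\<leftarrow>qs. q ^ 2)"
    using assms by (auto simp: sos_iff)
  have "cst c * q ^ 2 = (cst (sqrt c) * q) ^ 2" for q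
    using assms(2) by (simp add: power_mult_distrib power2_eq_square flip: cst_mult)
  then have "cst c * g = (\<Sum>q\<leftarrow>map (\<lambda>q. cst (sqrt c) * q) qs. q ^ 2)"
    by (simp add: *(2) o_def flip: sum_list_const_mult)
  moreover have "set (map (\<lambda>q. cst (sqrt c) * q) qs) \<subseteq> polys n"
    using *(1) by (auto intro: polys_cst_mult)
  ultimately show ?thesis using assms polys_le_cst_mult unfolding sos_iff by blast
qed

section \<open>Reducing the number of squares\<close>

text \<open>
  A rotation \<open>(p, q) \<mapsto> (c p + s q, c q - s p)\<close> with \<open>c\<^sup>2 + s\<^sup>2 = 1\<close> preserves \<open>p\<^sup>2 + q\<^sup>2\<close>, and a suitable
  angle removes the monomial \<open>m\<close> from the second polynomial. Rotating every member of the list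
  against one pivot \<open>p\<close> therefore leaves \<open>m\<close> in the pivot only.
\<close>

lemma eliminate_coefficient:
  fixes qs :: "real_mpoly list"
  assumes "\<forall>q\<in>set qs. Poly_Mapping.keys q \<subseteq> M"
  shows "\<exists>p ps. Poly_Mapping.keys p \<subseteq> M \<and>
    (\<forall>q\<in>set ps. Poly_Mapping.keys q \<subseteq> M \<and> Poly_Mapping.lookup q m = 0) \<and>
    (\<Sum>q\<leftarrow>qs. q ^ 2) = p ^ 2 + (\<Sum>q\<leftarrow>ps. q ^ 2)"
  using assms
proof (induction qs)
  case Nil
  show ?case by (intro exI[of _ 0] exI[of _ "[]"]) simp
next
  case (Cons q qs)
  then obtain p ps where IH: "Poly_Mapping.keys p \<subseteq> M"
    "\<forall>q\<in>set ps. Poly_Mapping.keys q \<subseteq> M \<and> Poly_Mapping.lookup q m = 0"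
    "(\<Sum>q\<leftarrow>qs. q ^ 2) = p ^ 2 + (\<Sum>q\<leftarrow>ps. q ^ 2)" by auto
  define a b where "a = Poly_Mapping.lookup p m" and "b = Poly_Mapping.lookup q m"
  define r where "r = sqrt (a ^ 2 + b ^ 2)"
  show ?case
  proof (cases "b = 0")
    case True
    show ?thesis
      by (intro exI[of _ p] exI[of _ "q # ps"]) (use IH Cons.prems True in \<open>auto simp: b_def\<close>)
  next
    case False
    then have r: "r \<noteq> 0" and r2: "r ^ 2 = a ^ 2 + b ^ 2"
      by (simp_all add: r_def sum_power2_gt_zero_iff add_nonneg_eq_0_iff)
    define p' q' where "p' = cst (a / r) * p + cst (b / r) * q"
      and "q' = cst (a / r) * q - cst (b / r) * p"
    have "cst (a / r) ^ 2 + cst (b / r) ^ 2 = cst ((a / r) ^ 2 + (b / r) ^ 2)"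
      by (simp only: cst_add cst_mult power2_eq_square)
    also have "(a / r) ^ 2 + (b / r) ^ 2 = 1"
      using r by (simp add: power_divide r2[symmetric] flip: add_divide_distrib)
    finally have cs: "cst (a / r) ^ 2 + cst (b / r) ^ 2 = 1" by simp
    have "p' ^ 2 + q' ^ 2 = (cst (a / r) ^ 2 + cst (b / r) ^ 2) * (p ^ 2 + q ^ 2)"
      by (simp add: p'_def q'_def power2_eq_square algebra_simps)
    then have "p' ^ 2 + q' ^ 2 = p ^ 2 + q ^ 2" by (simp add: cs)
    moreover have "Poly_Mapping.lookup q' m = 0"
      by (simp add: q'_def lookup_minus flip: a_def b_def)
    moreover have "Poly_Mapping.keys p' \<subseteq> M" "Poly_Mapping.keys q' \<subseteq> M"
      using IH(1) Cons.prems
      by (auto simp: p'_def q'_def keys_subset_iff lookup_add lookup_minus)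
    ultimately show ?thesis using IH
      by (intro exI[of _ p'] exI[of _ "q' # ps"])
        (auto simp: algebra_simps)
  qed
qed

text \<open>
  Eliminating the monomials of \<open>M\<close> one after the other leaves one square per monomial, however many
  squares there were at the start. In terms of Gram matrices this is a Cholesky factorization. The
  uniform number of squares is what makes limits of sums of squares accessible to compactness.
\<close>

lemma sum_of_card_many_squares:
  fixes qs :: "real_mpoly list"
  assumes "finite M" "\<forall>q\<in>set qs. Poly_Mapping.keys q \<subseteq> M"
  shows "\<exists>Q. (\<forall>m\<in>M. Poly_Mapping.keys (Q m) \<subseteq> M) \<and> (\<Sum>q\<leftarrow>qs. q ^ 2) = (\<Sum>m\<in>M. Q m ^ 2)"
  using assms
proof (induction M arbitrary: qs)
  case empty
  then have "(\<Sum>q\<leftarrow>qs. q ^ 2) = 0" by (induction qs) auto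
  then show ?case by simp
next
  case (insert m M)
  obtain p ps where p: "Poly_Mapping.keys p \<subseteq> insert m M"
    "\<forall>q\<in>set ps. Poly_Mapping.keys q \<subseteq> insert m M \<and> Poly_Mapping.lookup q m = 0"
    "(\<Sum>q\<leftarrow>qs. q ^ 2) = p ^ 2 + (\<Sum>q\<leftarrow>ps. q ^ 2)"
    using eliminate_coefficient[OF insert.prems] by blast
  have "\<forall>q\<in>set ps. Poly_Mapping.keys q \<subseteq> M"
    using p(2) by (auto simp: in_keys_iff)
  from insert.IH[OF this] obtain Q where Q: "\<forall>m\<in>M. Poly_Mapping.keys (Q m) \<subseteq> M"
    "(\<Sum>q\<leftarrow>ps. q ^ 2) = (\<Sum>m\<in>M. Q m ^ 2)" by blast
  have "(\<Sum>x\<in>M. (Q(m := p)) x ^ 2) = (\<Sum>m\<in>M. Q m ^ 2)"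
    using insert.hyps by (intro sum.cong) auto
  with Q p insert.hyps show ?case
    by (intro exI[of _ "Q(m := p)"]) auto
qed

section \<open>Leading parts of squares do not cancel\<close>

text \<open>
  Among the monomials of highest degree, one of maximal Euclidean length is a vertex of the convex
  hull of \<open>K\<close>: if \<open>m\<close> is the midpoint of \<open>a\<close> and \<open>b\<close>, both of them have the top degree, and strict
  convexity of the squared length \<open>\<Phi>\<close> forces \<open>a = b\<close>.
\<close>

lemma extreme_monomial:
  fixes K :: "(nat \<Rightarrow>\<^sub>0 nat) set"
  assumes "finite K" "K \<noteq> {}"
  obtains m where "m \<in> K" "\<And>a. a \<in> K \<Longrightarrow> monom_deg a \<le> monom_deg m"
    "\<And>a b. a \<in> K \<Longrightarrow> b \<in> K \<Longrightarrow> a + b = m + m \<Longrightarrow> a = m \<and> b = m"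
proof -
  define K' where "K' = {a \<in> K. monom_deg a = Max (monom_deg ` K)}"
  define \<Phi> :: "(nat \<Rightarrow>\<^sub>0 nat) \<Rightarrow> int" where
    "\<Phi> a = (\<Sum>i\<in>Poly_Mapping.keys a. (int (Poly_Mapping.lookup a i))\<^sup>2)" for a
  have "Max (monom_deg ` K) \<in> monom_deg ` K" using assms by simp
  then have K': "finite K'" "K' \<noteq> {}" using assms(1) by (auto simp: K'_def)
  then have "Max (\<Phi> ` K') \<in> \<Phi> ` K'" by simp
  then obtain m where m: "m \<in> K'" "\<Phi> m = Max (\<Phi> ` K')" by auto
  have \<Phi>_le: "\<Phi> a \<le> \<Phi> m" if "a \<in> K'" for a using that K' m by simp
  have deg: "monom_deg a \<le> monom_deg m" if "a \<in> K" for a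
    using that m(1) assms(1) by (simp add: K'_def)
  show ?thesis
  proof (rule that[of m])
    show "m \<in> K" using m(1) by (simp add: K'_def)
  next
    fix a b assume ab: "a \<in> K" "b \<in> K" "a + b = m + m"
    have "monom_deg a + monom_deg b = monom_deg m + monom_deg m"
      by (metis ab(3) monom_deg_add)
    with deg[OF ab(1)] deg[OF ab(2)] have "monom_deg a = monom_deg m" "monom_deg b = monom_deg m"
      by linarith+
    then have abK: "a \<in> K'" "b \<in> K'" using ab m(1) by (simp_all add: K'_def)
    let ?A = "Poly_Mapping.keys a \<union> Poly_Mapping.keys b \<union> Poly_Mapping.keys m"
    have \<Phi>: "\<Phi> c = (\<Sum>i\<in>?A. (int (Poly_Mapping.lookup c i))\<^sup>2)"
      if "Poly_Mapping.keys c \<subseteq> ?A" for c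
      unfolding \<Phi>_def by (rule sum.mono_neutral_left) (use that in \<open>auto simp: in_keys_iff\<close>)
    have "Poly_Mapping.keys a \<subseteq> ?A" "Poly_Mapping.keys b \<subseteq> ?A" "Poly_Mapping.keys m \<subseteq> ?A" by auto
    note \<Phi>s = this[THEN \<Phi>]
    have e: "int (Poly_Mapping.lookup a i) + int (Poly_Mapping.lookup b i)
        = 2 * int (Poly_Mapping.lookup m i)" for i
      using arg_cong[OF ab(3), of "\<lambda>x. int (Poly_Mapping.lookup x i)"] by (simp add: lookup_add)
    have "(int (Poly_Mapping.lookup a i) - int (Poly_Mapping.lookup b i))\<^sup>2
        = 2 * (int (Poly_Mapping.lookup a i))\<^sup>2 + 2 * (int (Poly_Mapping.lookup b i))\<^sup>2
          - 4 * (int (Poly_Mapping.lookup m i))\<^sup>2" for i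
    proof -
      have "(x - y)\<^sup>2 = 2 * x\<^sup>2 + 2 * y\<^sup>2 - (x + y)\<^sup>2" for x y :: int
        by (simp add: power2_eq_square algebra_simps)
      then show ?thesis using e[of i] by (simp add: power_mult_distrib)
    qed
    then have "(\<Sum>i\<in>?A. (int (Poly_Mapping.lookup a i) - int (Poly_Mapping.lookup b i))\<^sup>2)
        = 2 * \<Phi> a + 2 * \<Phi> b - 4 * \<Phi> m"
      using \<Phi>s by (simp add: sum.distrib sum_subtractf sum_distrib_left)
    also have "\<dots> \<le> 0" using \<Phi>_le[OF abK(1)] \<Phi>_le[OF abK(2)] by linarith
    finally have "(\<Sum>i\<in>?A. (int (Poly_Mapping.lookup a i) - int (Poly_Mapping.lookup b i))\<^sup>2) = 0"
      by (intro antisym sum_nonneg) auto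
    then have z: "\<forall>i\<in>?A. int (Poly_Mapping.lookup a i) = int (Poly_Mapping.lookup b i)"
      by (subst (asm) sum_nonneg_eq_0_iff) auto
    have "Poly_Mapping.lookup a i = Poly_Mapping.lookup b i" for i
      using z by (cases "i \<in> ?A") (auto simp: in_keys_iff)
    then have "a = b" by (intro poly_mapping_eqI) auto
    moreover have "Poly_Mapping.lookup a i = Poly_Mapping.lookup m i" for i
      using e[of i] \<open>a = b\<close> by simp
    then have "a = m" by (intro poly_mapping_eqI) auto
    ultimately show "a = m \<and> b = m" by simp
  qed (use deg in auto)
qed

text \<open>
  For an extreme monomial \<open>m\<close>, the only product of two monomials that yields \<open>2 m\<close> is \<open>m * m\<close>. So
  the coefficient of a sum of squares at \<open>2 m\<close> is itself a sum of squares of real numbers: the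
  leading parts of real squares cannot cancel.
\<close>

lemma extreme_monomial_sum_squares:
  fixes q :: "'j \<Rightarrow> real_mpoly"
  assumes "finite J" "\<exists>j\<in>J. q j \<noteq> 0"
  obtains m where "\<And>j a. j \<in> J \<Longrightarrow> a \<in> Poly_Mapping.keys (q j) \<Longrightarrow> monom_deg a \<le> monom_deg m"
    "0 < Poly_Mapping.lookup (\<Sum>j\<in>J. q j ^ 2) (m + m)"
proof -
  define K where "K = (\<Union>j\<in>J. Poly_Mapping.keys (q j))"
  have K: "finite K" "K \<noteq> {}" using assms by (auto simp: K_def)
  then obtain m where m: "m \<in> K" "\<And>a. a \<in> K \<Longrightarrow> monom_deg a \<le> monom_deg m"
    "\<And>a b. a \<in> K \<Longrightarrow> b \<in> K \<Longrightarrow> a + b = m + m \<Longrightarrow> a = m \<and> b = m"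
    using extreme_monomial by blast
  have "Poly_Mapping.lookup (q j ^ 2) (m + m) = (Poly_Mapping.lookup (q j) m)\<^sup>2" if "j \<in> J" for j
  proof -
    have "Poly_Mapping.lookup (q j ^ 2) (m + m) = (\<Sum>a\<in>K. \<Sum>b\<in>K.
        if a + b = m + m then Poly_Mapping.lookup (q j) a * Poly_Mapping.lookup (q j) b else 0)"
      unfolding power2_eq_square using that K(1)
      by (intro lookup_mult_finite) (auto simp: K_def)
    also have "\<dots> = (\<Sum>a\<in>K. \<Sum>b\<in>K. if a = m then if b = m then
        (Poly_Mapping.lookup (q j) m)\<^sup>2 else 0 else 0)"
    proof (intro sum.cong refl)
      fix a b assume ab: "a \<in> K" "b \<in> K"
      show "(if a + b = m + m then Poly_Mapping.lookup (q j) a * Poly_Mapping.lookup (q j) b else 0)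
          = (if a = m then if b = m then (Poly_Mapping.lookup (q j) m)\<^sup>2 else 0 else 0)"
        using m(3)[OF ab] by (cases "a + b = m + m") (auto simp: power2_eq_square)
    qed
    also have "\<dots> = (\<Sum>a\<in>K. if a = m then (Poly_Mapping.lookup (q j) m)\<^sup>2 else 0)"
      using m(1) K(1) by (intro sum.cong refl) simp
    also have "\<dots> = (Poly_Mapping.lookup (q j) m)\<^sup>2"
      using m(1) K(1) by simp
    finally show ?thesis .
  qed
  then have "Poly_Mapping.lookup (\<Sum>j\<in>J. q j ^ 2) (m + m) = (\<Sum>j\<in>J. (Poly_Mapping.lookup (q j) m)\<^sup>2)"
    by (simp add: lookup_sum)
  also obtain j where "j \<in> J" "Poly_Mapping.lookup (q j) m \<noteq> 0"
    using m(1) by (auto simp: K_def in_keys_iff)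
  then have "(\<Sum>j\<in>J. (Poly_Mapping.lookup (q j) m)\<^sup>2) > 0"
    using assms(1) by (intro sum_pos2[of _ j]) auto
  finally show ?thesis using that m(2) by (auto simp: K_def)
qed

lemma sum_squares_eq_0_mpoly:
  fixes q :: "'j \<Rightarrow> real_mpoly"
  assumes "finite J" "(\<Sum>j\<in>J. q j ^ 2) = 0" "j \<in> J"
  shows "q j = 0"
proof (rule ccontr)
  assume "q j \<noteq> 0"
  with assms(3) have "\<exists>j\<in>J. q j \<noteq> 0" by blast
  then obtain m where "0 < Poly_Mapping.lookup (\<Sum>j\<in>J. q j ^ 2) (m + m)"
    by (rule extreme_monomial_sum_squares[OF assms(1)])
  then show False by (simp add: assms(2))
qed

text \<open>
  The definition of \<open>sos\<close> bounds only the degree of the sum. Since leading parts do not cancel, the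
  polynomials that are squared have at most half that degree.
\<close>

lemma sos_summand_degree:
  assumes "set qs \<subseteq> polys n" "(\<Sum>q\<leftarrow>qs. q ^ 2) \<in> polys_le n (2 * d)" "q \<in> set qs"
  shows "q \<in> polys_le n d"
proof (cases "\<exists>j\<in>{0..<length qs}. qs ! j \<noteq> 0")
  case True
  then obtain m where
    m: "\<And>j a. j \<in> {0..<length qs} \<Longrightarrow> a \<in> Poly_Mapping.keys (qs ! j) \<Longrightarrow> monom_deg a \<le> monom_deg m"
    and pos: "0 < Poly_Mapping.lookup (\<Sum>j\<in>{0..<length qs}. (qs ! j) ^ 2) (m + m)"
    using extreme_monomial_sum_squares[of "{0..<length qs}" "(!) qs"] by auto
  have "(\<Sum>q\<leftarrow>qs. q ^ 2) = (\<Sum>j\<in>{0..<length qs}. (qs ! j) ^ 2)"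
    by (simp add: sum_list_sum_nth)
  with pos have "m + m \<in> Poly_Mapping.keys (\<Sum>q\<leftarrow>qs. q ^ 2)" by (simp add: in_keys_iff)
  then have "monom_deg (m + m) \<le> 2 * d" using assms(2) by (auto simp: polys_le_def monoms_def)
  then have "monom_deg m \<le> d" by (simp add: monom_deg_add)
  moreover obtain j where "j < length qs" "q = qs ! j" using assms(3) by (auto simp: in_set_conv_nth)
  ultimately show ?thesis using m[of j] assms(1,3)
    by (fastforce simp: polys_le_def monoms_def polys_def)
next
  case False
  then show ?thesis using assms(3) by (auto simp: in_set_conv_nth)
qed

section \<open>The cone of sums of squares is closed\<close>

lemma common_convergent_subsequence:
  fixes x :: "'i \<Rightarrow> nat \<Rightarrow> real"
  assumes "finite I" "\<forall>i\<in>I. Bseq (x i)"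
  shows "\<exists>r l. strict_mono (r :: nat \<Rightarrow> nat) \<and> (\<forall>i\<in>I. (\<lambda>k. x i (r k)) \<longlonglongrightarrow> l i)"
  using assms
proof (induction I)
  case empty
  show ?case by (auto intro: exI[of _ id] simp: strict_mono_def)
next
  case (insert i I)
  then obtain r l where r: "strict_mono r" "\<forall>i\<in>I. (\<lambda>k. x i (r k)) \<longlonglongrightarrow> l i" by auto
  obtain s where s: "strict_mono s" "monoseq (\<lambda>k. x i (r (s k)))"
    using seq_monosub[of "\<lambda>k. x i (r k)"] by blast
  have "Bseq (\<lambda>k. x i (r (s k)))"
    using insert.prems by (auto simp: Bseq_def)
  then obtain L where L: "(\<lambda>k. x i (r (s k))) \<longlonglongrightarrow> L"
    using Bseq_monoseq_convergent s(2) by (auto simp: convergent_def)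
  have "(\<lambda>k. x j (r (s k))) \<longlonglongrightarrow> l j" if "j \<in> I" for j
    using LIMSEQ_subseq_LIMSEQ[OF _ s(1), of "\<lambda>k. x j (r k)"] r(2) that by (auto simp: o_def)
  then have "\<forall>j\<in>insert i I. (\<lambda>k. x j ((r \<circ> s) k)) \<longlonglongrightarrow> (l(i := L)) j"
    using L insert.hyps by auto
  then show ?case using strict_mono_o[OF r(1) s(1)] by blast
qed

lemma tendsto_sum_squares:
  fixes q :: "nat \<Rightarrow> 'j \<Rightarrow> real_mpoly"
  assumes "finite M" "\<And>k j. j \<in> J \<Longrightarrow> Poly_Mapping.keys (q k j) \<subseteq> M"
    "\<And>j. j \<in> J \<Longrightarrow> Poly_Mapping.keys (p j) \<subseteq> M"
    "\<And>j b. j \<in> J \<Longrightarrow> b \<in> M \<Longrightarrow> (\<lambda>k. Poly_Mapping.lookup (q k j) b) \<longlonglongrightarrow> Poly_Mapping.lookup (p j) b"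
  shows "(\<lambda>k. Poly_Mapping.lookup (\<Sum>j\<in>J. q k j ^ 2) c) \<longlonglongrightarrow> Poly_Mapping.lookup (\<Sum>j\<in>J. p j ^ 2) c"
proof -
  have "(\<lambda>k. Poly_Mapping.lookup (q k j ^ 2) c) \<longlonglongrightarrow> Poly_Mapping.lookup (p j ^ 2) c"
    if j: "j \<in> J" for j
    unfolding power2_eq_square
      lookup_mult_finite[OF assms(1) assms(2)[OF j] assms(2)[OF j]]
      lookup_mult_finite[OF assms(1) assms(3)[OF j] assms(3)[OF j]]
    by (intro tendsto_sum) (auto intro!: tendsto_mult assms(4) j)
  then show ?thesis unfolding lookup_sum by (intro tendsto_sum)
qed

lemma bounded_family_convergent_subsequence:
  fixes q :: "nat \<Rightarrow> 'j \<Rightarrow> real_mpoly"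
  assumes "finite J" "finite M"
    and bnd: "\<forall>k. \<forall>j\<in>J. \<forall>b\<in>M. \<bar>Poly_Mapping.lookup (q k j) b\<bar> \<le> B"
  shows "\<exists>r p. strict_mono (r :: nat \<Rightarrow> nat) \<and> (\<forall>j. Poly_Mapping.keys (p j) \<subseteq> M) \<and>
    (\<forall>j\<in>J. \<forall>b\<in>M. (\<lambda>k. Poly_Mapping.lookup (q (r k) j) b) \<longlonglongrightarrow> Poly_Mapping.lookup (p j) b)"
proof -
  have "\<forall>i\<in>J \<times> M. Bseq (\<lambda>k. Poly_Mapping.lookup (q k (fst i)) (snd i))"
    using bnd by (auto intro!: BseqI'[of _ B])
  from common_convergent_subsequence[OF finite_cartesian_product[OF assms(1,2)] this]
  obtain r l where r: "strict_mono r" and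
    l: "\<forall>i\<in>J \<times> M. (\<lambda>k. Poly_Mapping.lookup (q (r k) (fst i)) (snd i)) \<longlonglongrightarrow> l i" by blast
  define p :: "'j \<Rightarrow> real_mpoly" where "p j = (\<Sum>b\<in>M. Poly_Mapping.single b (l (j, b)))" for j
  have p: "Poly_Mapping.lookup (p j) b = (if b \<in> M then l (j, b) else 0)" for j b
    using assms(2) by (simp add: p_def lookup_sum lookup_single when_def)
  have "\<forall>j. Poly_Mapping.keys (p j) \<subseteq> M"
    by (simp add: p keys_subset_iff)
  moreover have "\<forall>j\<in>J. \<forall>b\<in>M. (\<lambda>k. Poly_Mapping.lookup (q (r k) j) b) \<longlonglongrightarrow> Poly_Mapping.lookup (p j) b"
    using l by (simp add: p)
  ultimately show ?thesis using r by blast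
qed

text \<open>
  If the coefficients of the sums stay bounded, so do those of the polynomials that are squared.
  Otherwise, rescale a subsequence to total coefficient size \<open>1\<close>: a limit point would be a nonzero
  family whose squares add up to zero.
\<close>

lemma sum_squares_bounded_coefficients:
  fixes q :: "nat \<Rightarrow> 'j \<Rightarrow> real_mpoly"
  assumes fin: "finite J" "finite M" and keys: "\<And>k j. j \<in> J \<Longrightarrow> Poly_Mapping.keys (q k j) \<subseteq> M"
    and bnd: "\<And>c. Bseq (\<lambda>k. Poly_Mapping.lookup (\<Sum>j\<in>J. q k j ^ 2) c)"
  shows "\<exists>B. \<forall>k. \<forall>j\<in>J. \<forall>b\<in>M. \<bar>Poly_Mapping.lookup (q k j) b\<bar> \<le> B"
proof -
  define s where "s k = (\<Sum>j\<in>J. \<Sum>b\<in>M. \<bar>Poly_Mapping.lookup (q k j) b\<bar>)" for k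
  have le_s: "\<bar>Poly_Mapping.lookup (q k j) b\<bar> \<le> s k" if "j \<in> J" "b \<in> M" for k j b
  proof -
    have "\<bar>Poly_Mapping.lookup (q k j) b\<bar> \<le> (\<Sum>b\<in>M. \<bar>Poly_Mapping.lookup (q k j) b\<bar>)"
      using fin that by (intro member_le_sum) auto
    also have "\<dots> \<le> s k"
      unfolding s_def using fin that
      by (intro member_le_sum[of j J "\<lambda>j. \<Sum>b\<in>M. \<bar>Poly_Mapping.lookup (q k j) b\<bar>"]) (auto intro: sum_nonneg)
    finally show ?thesis .
  qed
  have "\<exists>B. \<forall>k. s k \<le> B"
  proof (rule ccontr)
    assume "\<nexists>B. \<forall>k. s k \<le> B"
    then have "\<forall>N :: nat. \<exists>k. s k > real (Suc N)" by (meson not_le)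
    then obtain u where u: "\<And>N. s (u N) > real (Suc N)" by metis
    define t where "t N = 1 / s (u N)" for N
    have su: "s (u N) > 0" for N using u[of N] by linarith
    have t_le: "0 < t N" "t N \<le> 1 / real (Suc N)" for N
      using u[of N] su[of N] by (auto simp: t_def intro!: divide_left_mono)
    have t0: "t \<longlonglongrightarrow> 0"
      by (rule tendsto_sandwich[OF _ _ tendsto_const LIMSEQ_Suc[OF lim_1_over_n]])
        (use t_le in \<open>auto intro: less_imp_le always_eventually\<close>)
    define q' where "q' N j = cst (t N) * q (u N) j" for N j
    have "\<forall>N. \<forall>j\<in>J. \<forall>b\<in>M. \<bar>Poly_Mapping.lookup (q' N j) b\<bar> \<le> 1"
      using le_s su by (simp add: q'_def t_def abs_mult abs_of_pos divide_le_eq_1_pos)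
    from bounded_family_convergent_subsequence[OF fin this]
    obtain r p where r: "strict_mono r" and p: "\<forall>j. Poly_Mapping.keys (p j) \<subseteq> M"
      and lim: "\<forall>j\<in>J. \<forall>b\<in>M.
        (\<lambda>k. Poly_Mapping.lookup (q' (r k) j) b) \<longlonglongrightarrow> Poly_Mapping.lookup (p j) b" by blast
    have tr0: "(\<lambda>k. t (r k)) \<longlonglongrightarrow> 0"
      using LIMSEQ_subseq_LIMSEQ[OF t0 r] by (simp add: o_def)
    have "Poly_Mapping.lookup (\<Sum>j\<in>J. p j ^ 2) c = 0" for c
    proof (rule LIMSEQ_unique)
      show "(\<lambda>k. Poly_Mapping.lookup (\<Sum>j\<in>J. q' (r k) j ^ 2) c)
          \<longlonglongrightarrow> Poly_Mapping.lookup (\<Sum>j\<in>J. p j ^ 2) c"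
        using keys p lim by (intro tendsto_sum_squares[OF fin(2)]) (auto simp: q'_def keys_subset_iff)
      have "(\<Sum>j\<in>J. q' N j ^ 2) = cst (t N ^ 2) * (\<Sum>j\<in>J. q (u N) j ^ 2)" for N
        by (simp add: q'_def sum_distrib_left power_mult_distrib cst_mult power2_eq_square mult_ac)
      then have e: "Poly_Mapping.lookup (\<Sum>j\<in>J. q' (r k) j ^ 2) c
          = t (r k) ^ 2 * Poly_Mapping.lookup (\<Sum>j\<in>J. q (u (r k)) j ^ 2) c" for k by simp
      have "Bseq (\<lambda>k. Poly_Mapping.lookup (\<Sum>j\<in>J. q (u (r k)) j ^ 2) c)"
        using bnd[of c] by (auto simp: Bseq_def)
      moreover have "(\<lambda>k. t (r k) ^ 2) \<longlonglongrightarrow> 0" using tendsto_power[OF tr0, of 2] by simp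
      ultimately show "(\<lambda>k. Poly_Mapping.lookup (\<Sum>j\<in>J. q' (r k) j ^ 2) c) \<longlonglongrightarrow> 0"
        using bounded_bilinear.Zfun_prod_Bfun[OF bounded_bilinear_mult]
        unfolding e by (simp add: tendsto_Zfun_iff)
    qed
    then have "(\<Sum>j\<in>J. p j ^ 2) = 0" by (intro poly_mapping_eqI) simp
    then have p0: "p j = 0" if "j \<in> J" for j
      by (rule sum_squares_eq_0_mpoly[OF fin(1) _ that])
    have "(\<lambda>k. \<Sum>j\<in>J. \<Sum>b\<in>M. \<bar>Poly_Mapping.lookup (q' (r k) j) b\<bar>)
        \<longlonglongrightarrow> (\<Sum>j\<in>J. \<Sum>b\<in>M. \<bar>Poly_Mapping.lookup (p j) b\<bar>)"
      by (rule tendsto_sum, rule tendsto_sum, rule tendsto_rabs) (use lim in blast)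
    moreover have "(\<Sum>j\<in>J. \<Sum>b\<in>M. \<bar>Poly_Mapping.lookup (q' N j) b\<bar>) = 1" for N
    proof -
      have "(\<Sum>j\<in>J. \<Sum>b\<in>M. \<bar>Poly_Mapping.lookup (q' N j) b\<bar>) = t N * s (u N)"
        using t_le(1)[of N] by (simp add: q'_def s_def abs_mult sum_distrib_left)
      then show ?thesis using su[of N] by (simp add: t_def)
    qed
    ultimately show False by (simp add: p0 LIMSEQ_const_iff)
  qed
  then show ?thesis using le_s order_trans by blast
qed

text \<open>
  The cone of sums of squares is closed. The number of squares and their coefficients are bounded, so
  a subsequence of the representations converges, and its limit represents the limit polynomial.
\<close>

lemma sos_closed:
  assumes G: "\<And>k. G k \<in> sos n d"
    and lim: "\<And>c. (\<lambda>k. Poly_Mapping.lookup (G k) c) \<longlonglongrightarrow> Poly_Mapping.lookup g c"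
  shows "g \<in> sos n d"
proof -
  let ?M = "monoms n d"
  have "\<exists>Q. (\<forall>m\<in>?M. Poly_Mapping.keys (Q m) \<subseteq> ?M) \<and> G k = (\<Sum>m\<in>?M. Q m ^ 2)" for k
  proof -
    obtain qs where qs: "set qs \<subseteq> polys n" "G k = (\<Sum>q\<leftarrow>qs. q ^ 2)" "G k \<in> polys_le n (2 * d)"
      using G[of k] by (auto simp: sos_iff)
    then have "\<forall>q\<in>set qs. Poly_Mapping.keys q \<subseteq> ?M"
      using sos_summand_degree[of qs n d] by (auto simp: polys_le_def)
    from sum_of_card_many_squares[OF finite_monoms this] qs(2) show ?thesis by simp
  qed
  then obtain Q where Q: "\<And>k m. m \<in> ?M \<Longrightarrow> Poly_Mapping.keys (Q k m) \<subseteq> ?M"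
    "\<And>k. G k = (\<Sum>m\<in>?M. Q k m ^ 2)" by metis
  have "Bseq (\<lambda>k. Poly_Mapping.lookup (\<Sum>m\<in>?M. Q k m ^ 2) c)" for c
    using convergentI[OF lim[of c]] convergent_imp_Bseq Q(2) by simp
  with Q(1) obtain B where "\<forall>k. \<forall>m\<in>?M. \<forall>b\<in>?M. \<bar>Poly_Mapping.lookup (Q k m) b\<bar> \<le> B"
    using sum_squares_bounded_coefficients[OF finite_monoms finite_monoms] by blast
  from bounded_family_convergent_subsequence[OF finite_monoms finite_monoms this]
  obtain r p where r: "strict_mono r" and p: "\<forall>m. Poly_Mapping.keys (p m) \<subseteq> ?M"
    and pl: "\<forall>m\<in>?M. \<forall>b\<in>?M.
      (\<lambda>k. Poly_Mapping.lookup (Q (r k) m) b) \<longlonglongrightarrow> Poly_Mapping.lookup (p m) b" by blast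
  have "g = (\<Sum>m\<in>?M. p m ^ 2)"
  proof (rule poly_mapping_eqI, rule LIMSEQ_unique)
    fix c
    show "(\<lambda>k. Poly_Mapping.lookup (G (r k)) c) \<longlonglongrightarrow> Poly_Mapping.lookup g c"
      using LIMSEQ_subseq_LIMSEQ[OF lim r] by (simp add: o_def)
    show "(\<lambda>k. Poly_Mapping.lookup (G (r k)) c) \<longlonglongrightarrow> Poly_Mapping.lookup (\<Sum>m\<in>?M. p m ^ 2) c"
      unfolding Q(2) by (intro tendsto_sum_squares[OF finite_monoms]) (use Q(1) p pl in auto)
  qed
  moreover have "(\<Sum>m\<in>A. p m ^ 2) \<in> sos n d" if "finite A" for A
    using that p by (induction A) (auto intro!: sos_square simp: polys_le_def)
  ultimately show ?thesis by simp
qed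

section \<open>Perturbing a polynomial into the cone\<close>

text \<open>
  The price of moving \<open>p\<close> into the cone: \<open>liftable n d r p\<close> allows the perturbations of the
  theorem, with total weight at most \<open>r\<close>. This relation is subadditive and homogeneous in \<open>(r, p)\<close>, so
  an upper bound for single monomials gives one for all polynomials.
\<close>

definition liftable :: "nat \<Rightarrow> nat \<Rightarrow> real \<Rightarrow> real_mpoly \<Rightarrow> bool" where
  "liftable n d r p \<longleftrightarrow> (\<exists>l. (\<forall>i\<in>{0..n}. 0 \<le> l i) \<and> (\<Sum>i = 0..n. l i) \<le> r \<and> perturb n d p l \<in> sos n d)"

lemma perturb_add: "perturb n d (p + q) (\<lambda>i. l i + k i) = perturb n d p l + perturb n d q k"
  by (simp add: perturb_def cst_add sum.distrib algebra_simps)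

lemma perturb_scale: "perturb n d (cst c * p) (\<lambda>i. c * l i) = cst c * perturb n d p l"
  by (simp add: perturb_def cst_mult sum_distrib_left algebra_simps)

lemma perturb_0: "perturb n d p (\<lambda>i. 0) = p"
  by (simp add: perturb_def)

lemma liftable_add:
  assumes "liftable n d r p" "liftable n d s q"
  shows "liftable n d (r + s) (p + q)"
proof -
  obtain l k where "\<forall>i\<in>{0..n}. 0 \<le> l i" "(\<Sum>i = 0..n. l i) \<le> r" "perturb n d p l \<in> sos n d"
    "\<forall>i\<in>{0..n}. 0 \<le> k i" "(\<Sum>i = 0..n. k i) \<le> s" "perturb n d q k \<in> sos n d"
    using assms by (auto simp: liftable_def)
  then show ?thesis unfolding liftable_def
    by (intro exI[of _ "\<lambda>i. l i + k i"]) (auto simp: perturb_add sum.distrib)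
qed

lemma liftable_scale:
  assumes "liftable n d r p" "0 \<le> c"
  shows "liftable n d (c * r) (cst c * p)"
proof -
  obtain l where "\<forall>i\<in>{0..n}. 0 \<le> l i" "(\<Sum>i = 0..n. l i) \<le> r" "perturb n d p l \<in> sos n d"
    using assms by (auto simp: liftable_def)
  then show ?thesis unfolding liftable_def using assms(2)
    by (intro exI[of _ "\<lambda>i. c * l i"])
      (auto simp: perturb_scale sos_scale mult_left_mono simp flip: sum_distrib_left)
qed

lemma liftable_sos: "p \<in> sos n d \<Longrightarrow> liftable n d 0 p"
  unfolding liftable_def by (intro exI[of _ "\<lambda>i. 0"]) (simp add: perturb_0)

lemma liftable_sum:
  assumes "finite A" "\<And>a. a \<in> A \<Longrightarrow> liftable n d (r a) (p a)"
  shows "liftable n d (\<Sum>a\<in>A. r a) (\<Sum>a\<in>A. p a)"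
  using assms by (induction A) (auto simp: liftable_add liftable_sos)

lemma liftable_of_nat_mult:
  assumes "liftable n d r p"
  shows "liftable n d (real k * r) (of_nat k * p)"
  using liftable_scale[OF assms, of "real k"] by (simp add: cst_of_nat)

text \<open>
  The variables together with a homogenizing variable of index \<open>0\<close>, evaluated at \<open>1\<close>. The constant
  term of the perturbation is then one more power \<open>hvar 0 ^ (2 * d)\<close>, and every monomial of degree
  at most \<open>d\<close> is a product of powers whose exponents sum to exactly \<open>d\<close>.
\<close>

definition hvar :: "nat \<Rightarrow> real_mpoly" where
  "hvar i = (if i = 0 then 1 else var i)"

lemma hvar_power_le: "i \<in> {0..n} \<Longrightarrow> hvar i ^ k \<in> polys_le n k"
  using polys_le_power[OF polys_le_var, of i n k] polys_le_power[OF polys_le_1, of n 0 k]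
  by (cases "i = 0") (auto simp: hvar_def)

lemma perturb_hvar:
  "perturb n d p l = p + (\<Sum>i = 0..n. cst (l i) * hvar i ^ (2 * d))"
proof -
  have "(\<Sum>i = 0..n. cst (l i) * hvar i ^ (2 * d)) =
      cst (l 0) * hvar 0 ^ (2 * d) + (\<Sum>i = 1..n. cst (l i) * hvar i ^ (2 * d))"
    by (simp add: sum.atLeast_Suc_atMost)
  also have "\<dots> = cst (l 0) + (\<Sum>i = 1..n. cst (l i) * var i ^ (2 * d))"
    by (auto simp: hvar_def intro!: sum.cong)
  finally show ?thesis by (simp add: perturb_def)
qed

lemma liftable_neg_hvar_power:
  assumes "j \<in> {0..n}"
  shows "liftable n d 1 (- ((hvar j ^ d) ^ 2))"
proof -
  let ?l = "\<lambda>i. if i = j then 1 else 0 :: real"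
  have "(\<Sum>i = 0..n. cst (?l i) * hvar i ^ (2 * d)) = hvar j ^ (2 * d)"
    using assms by (simp add: if_distrib[of cst] if_distrib[of "\<lambda>x. x * _"] cong: if_cong)
  then have "perturb n d (- ((hvar j ^ d) ^ 2)) ?l = 0"
    by (simp add: perturb_hvar power_mult[symmetric] mult.commute)
  then show ?thesis unfolding liftable_def using assms
    by (intro exI[of _ ?l]) auto
qed

section \<open>Arithmetic and geometric means as a sum of squares\<close>

text \<open>
  A convex sequence satisfies \<open>(k + 1) M k \<le> k M (k + 1) + M 0\<close>. Here \<open>\<le>\<close> is the order in which a
  polynomial is nonnegative if it is a sum of squares, and convexity means that the second
  differences are nonnegative in this order.
\<close>

lemma chain_convex:
  fixes M :: "nat \<Rightarrow> real_mpoly"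
  assumes convex: "\<And>k. k + 2 \<le> s \<Longrightarrow> M k - 2 * M (k + 1) + M (k + 2) \<in> sos n d"
  shows "k < s \<Longrightarrow> of_nat k * M (k + 1) + M 0 - of_nat (k + 1) * M k \<in> sos n d"
proof (induction k)
  case 0
  then show ?case by simp
next
  case (Suc k)
  let ?a = "of_nat (k + 1) :: real_mpoly"
  have "cst (real (k + 1)) * (M k - 2 * M (k + 1) + M (k + 2)) \<in> sos n d"
    using Suc.prems by (intro sos_scale convex) auto
  then have "?a * (M k - 2 * M (k + 1) + M (k + 2))
      + (of_nat k * M (k + 1) + M 0 - ?a * M k) \<in> sos n d"
    using Suc by (intro sos_add) (simp_all only: cst_of_nat Suc_lessD)
  also have "?a * (M k - 2 * M (k + 1) + M (k + 2)) + (of_nat k * M (k + 1) + M 0 - ?a * M k)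
      = of_nat (Suc k) * M (Suc k + 1) + M 0 - of_nat (Suc k + 1) * M (Suc k)"
    by (simp add: algebra_simps)
  finally show ?case .
qed

text \<open>
  The inequality for convex sequences bounds \<open>M k\<close> by an average of \<open>M (k + 1)\<close> and \<open>M 0\<close>, so \<open>- M k\<close>
  costs at most an average of two prices that are at most \<open>1\<close>. The induction descends from the upper end.
\<close>

lemma liftable_neg_chain:
  fixes M :: "nat \<Rightarrow> real_mpoly"
  assumes convex: "\<And>k. k + 2 \<le> s \<Longrightarrow> M k - 2 * M (k + 1) + M (k + 2) \<in> sos n d"
    and ends: "liftable n d 1 (- M 0)" "liftable n d 1 (- M s)"
    and "k \<le> s"
  shows "liftable n d 1 (- M k)"
  using \<open>k \<le> s\<close>
proof (induction k rule: inc_induct)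
  case base
  show ?case by (rule ends(2))
next
  case (step k)
  let ?D = "of_nat k * M (k + 1) + M 0 - of_nat (k + 1) * M k"
  have D: "?D \<in> sos n d" using chain_convex[of s M n d k] convex step.hyps by blast
  have "liftable n d (0 + (real k * 1 + 1)) (?D + (of_nat k * (- M (Suc k)) + (- M 0)))"
    by (intro liftable_add liftable_sos D liftable_of_nat_mult step.IH ends(1))
  then have "liftable n d (real (k + 1)) (of_nat (k + 1) * (- M k))"
    by (simp add: algebra_simps)
  from liftable_scale[OF this, of "1 / real (k + 1)"]
  have "liftable n d (1 / real (k + 1) * real (k + 1))
      (cst (1 / real (k + 1)) * (of_nat (k + 1) * (- M k)))" by simp
  also have "1 / real (k + 1) * real (k + 1) = 1" by simp
  also have "cst (1 / real (k + 1)) * (of_nat (k + 1) * (- M k)) = - M k"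
    by (simp only: cst_of_nat[symmetric] mult.assoc[symmetric] cst_mult[symmetric]) simp
  finally show ?case .
qed

text \<open>
  Moving exponents from \<open>y\<close> to \<open>x\<close> in a squared monomial gives a convex sequence, its second difference
  being the square of \<open>P a b (y\<^sup>2 - x\<^sup>2)\<close>.
\<close>

lemma second_difference_square:
  fixes P a b x y :: "'a :: comm_ring_1"
  shows "(P * (a * (b * y ^ 2)) - P * ((a * x ^ 2) * b)) ^ 2 =
    (P * a * (b * y ^ 2)) ^ 2 - 2 * (P * (a * x) * (b * y)) ^ 2 + (P * (a * x ^ 2) * b) ^ 2"
  by (simp add: power2_eq_square algebra_simps)

text \<open>
  The inequality of arithmetic and geometric means, as a sum of squares. If two variables occur, the
  monomial lies on a convex chain along which their joint exponent \<open>s\<close> is distributed between them. At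
  each end of the chain one of the two has disappeared, so the number of variables decreases until a
  pure power is left, and this is cancelled by the perturbation of weight \<open>1\<close>.
\<close>

lemma liftable_neg_even_monomial:
  assumes "I \<subseteq> {0..n}" "I \<noteq> {}" "(\<Sum>i\<in>I. e i) = d"
  shows "liftable n d 1 (- ((\<Prod>i\<in>I. hvar i ^ e i) ^ 2))"
  using assms
proof (induction "card I" arbitrary: I e rule: less_induct)
  case less
  have fin: "finite I" using less.prems(1) finite_subset by blast
  show ?case
  proof (cases "\<exists>i j. i \<in> I \<and> j \<in> I \<and> i \<noteq> j")
    case False
    then obtain i where "I = {i}" using less.prems(2) by blast
    then show ?thesis using less.prems liftable_neg_hvar_power[of i n d] by simp
  next
    case True
    then obtain i j where ij: "i \<in> I" "j \<in> I" "i \<noteq> j" by blast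
    define K where "K = I - {i, j}"
    have I: "I = insert i (insert j K)" "i \<notin> K" "j \<notin> K" "finite K" "K \<subseteq> {0..n}"
      using ij fin less.prems(1) by (auto simp: K_def)
    define s where "s = e i + e j"
    define R where "R = (\<Prod>i\<in>K. hvar i ^ e i)"
    define M where "M k = (R * hvar i ^ k * hvar j ^ (s - k)) ^ 2" for k
    have d: "d = (\<Sum>i\<in>K. e i) + s" using less.prems(3) I ij(3) by (simp add: s_def)
    have sub: "liftable n d 1 (- ((R * hvar a ^ s) ^ 2))" if a: "a = i \<or> a = j" for a
    proof -
      have "liftable n d 1 (- ((\<Prod>k\<in>insert a K. hvar k ^ (e(a := s)) k) ^ 2))"
      proof (rule less.hyps)
        show "card (insert a K) < card I" using I ij(3) a by auto
        show "insert a K \<subseteq> {0..n}" using I less.prems(1) a by auto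
        have "(\<Sum>k\<in>K. (e(a := s)) k) = (\<Sum>k\<in>K. e k)" using I a by (intro sum.cong) auto
        then show "(\<Sum>k\<in>insert a K. (e(a := s)) k) = d" using I a d by auto
      qed simp
      moreover have "(\<Prod>k\<in>K. hvar k ^ (e(a := s)) k) = R"
        unfolding R_def using I a by (intro prod.cong) auto
      ultimately show ?thesis using I a by (auto simp: mult.commute)
    qed
    have "liftable n d 1 (- M (e i))"
    proof (rule liftable_neg_chain)
      show "liftable n d 1 (- M 0)" "liftable n d 1 (- M s)"
        using sub[of i] sub[of j] by (simp_all add: M_def)
      show "e i \<le> s" by (simp add: s_def)
      fix k assume k: "k + 2 \<le> s"
      \<comment> \<open>The common factor of the three neighbours has exponents \<open>k\<close> and \<open>t\<close>.\<close>
      then obtain t where t: "s = k + t + 2" by (metis add.assoc add.commute le_Suc_ex)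
      define q where "q = R * (hvar i ^ k * hvar j ^ (t + 2)) - R * (hvar i ^ (k + 2) * hvar j ^ t)"
      have R: "R \<in> polys_le n (\<Sum>i\<in>K. e i)"
        unfolding R_def using I by (intro polys_le_prod hvar_power_le) auto
      have hv: "R * (hvar i ^ a * hvar j ^ b) \<in> polys_le n d" if "a + b = s" for a b
        using polys_le_mult[OF R polys_le_mult[OF hvar_power_le hvar_power_le], of i j a b]
          I less.prems(1) d that by auto
      have "q \<in> polys_le n d" unfolding q_def by (intro polys_le_diff hv) (simp_all add: t)
      then have "q ^ 2 \<in> sos n d" by (rule sos_square)
      also have "q ^ 2 = (R * hvar i ^ k * (hvar j ^ t * hvar j ^ 2)) ^ 2
          - 2 * (R * (hvar i ^ k * hvar i) * (hvar j ^ t * hvar j)) ^ 2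
          + (R * (hvar i ^ k * hvar i ^ 2) * hvar j ^ t) ^ 2"
        unfolding q_def power_add by (rule second_difference_square)
      also have "\<dots> = M k - 2 * M (k + 1) + M (k + 2)"
      proof -
        have "s - k = t + 2" "s - (k + 1) = t + 1" "s - (k + 2) = t" by (simp_all add: t)
        then show ?thesis by (simp only: M_def power_add power_one_right)
      qed
      finally show "M k - 2 * M (k + 1) + M (k + 2) \<in> sos n d" .
    qed
    moreover have "(\<Prod>i\<in>I. hvar i ^ e i) = R * hvar i ^ e i * hvar j ^ (s - e i)"
      using I ij(3) by (simp add: R_def s_def mult_ac)
    ultimately show ?thesis by (simp add: M_def)
  qed
qed

lemma liftable_neg_square_single:
  assumes "m \<in> monoms n d"
  shows "liftable n d 1 (- (Poly_Mapping.single m 1 ^ 2))"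
proof -
  let ?e = "\<lambda>i. if i = 0 then d - monom_deg m else Poly_Mapping.lookup m i"
  have m: "Poly_Mapping.keys m \<subseteq> {1..n}" "monom_deg m \<le> d" using assms by (auto simp: monoms_def)
  have split: "{0..n} = insert 0 {1..n}" by auto
  have "(\<Sum>i\<in>{0..n}. ?e i) = d"
  proof -
    have "(\<Sum>i\<in>{1..n}. ?e i) = monom_deg m"
      unfolding monom_deg_superset[OF finite_atLeastAtMost m(1)] by (rule sum.cong) auto
    then show ?thesis using m(2) unfolding split by (subst sum.insert) auto
  qed
  from liftable_neg_even_monomial[of "{0..n}" n ?e, OF _ _ this]
  have "liftable n d 1 (- ((\<Prod>i\<in>{0..n}. hvar i ^ ?e i) ^ 2))" by simp
  also have "(\<Prod>i\<in>{0..n}. hvar i ^ ?e i) = (\<Prod>i\<in>{1..n}. var i ^ Poly_Mapping.lookup m i)"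
    unfolding split by (subst prod.insert) (auto simp: hvar_def intro!: prod.cong)
  also have "\<dots> = Poly_Mapping.single m 1" using m by (intro single_eq_prod_var[symmetric]) auto
  finally show ?thesis .
qed

text \<open>
  Write the monomial as \<open>u v\<close> with both factors of degree at most \<open>d\<close>. Then \<open>\<plusminus> 2 u v\<close> is the square
  of \<open>u \<plusminus> v\<close> minus \<open>u\<^sup>2\<close> and \<open>v\<^sup>2\<close>, and these two negative squares cost \<open>1\<close> each.
\<close>

lemma liftable_single:
  assumes "m \<in> monoms n (2 * d)"
  shows "liftable n d \<bar>c\<bar> (Poly_Mapping.single m c)"
proof -
  obtain u v where uv: "u \<in> monoms n d" "v \<in> monoms n d" "m = u + v"
    using monomial_split[of m n d d] assms by (auto simp: mult_2)
  \<comment> \<open>The sign of \<open>c\<close> is absorbed into \<open>v\<close>, so that \<open>2 U V\<close> is \<open>2 sgn c u v\<close>.\<close>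
  define U V :: real_mpoly where "U = Poly_Mapping.single u 1" and "V = cst (sgn c) * Poly_Mapping.single v 1"
  have V2: "liftable n d 1 (- (V ^ 2))"
  proof (cases "c = 0")
    case True
    then show ?thesis
      by (simp add: V_def liftable_def perturb_0 exI[of _ "\<lambda>i. 0"])
  next
    case False
    then have "sgn c * sgn c = 1" by (simp add: sgn_if)
    then have "V ^ 2 = Poly_Mapping.single v 1 ^ 2"
      by (simp add: V_def power_mult_distrib power2_eq_square[of "cst _"] flip: cst_mult)
    then show ?thesis using liftable_neg_square_single[OF uv(2)] by simp
  qed
  have "U + V \<in> polys_le n d"
    unfolding U_def V_def using uv by (intro polys_le_add polys_le_cst_mult polys_le_single)
  then have "(U + V) ^ 2 \<in> sos n d" by (rule sos_square)
  then have "liftable n d (0 + (1 + 1)) ((U + V) ^ 2 + (- (U ^ 2) + - (V ^ 2)))"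
    using liftable_neg_square_single[OF uv(1)] V2
    by (intro liftable_add liftable_sos) (simp_all add: U_def)
  from liftable_scale[OF this, of "\<bar>c\<bar> / 2"]
  have "liftable n d \<bar>c\<bar> (cst (\<bar>c\<bar> / 2) * ((U + V) ^ 2 + (- (U ^ 2) + - (V ^ 2))))" by simp
  also have "(U + V) ^ 2 + (- (U ^ 2) + - (V ^ 2)) = cst 2 * (U * V)"
    by (simp add: power2_eq_square algebra_simps cst_def)
  also have "cst (\<bar>c\<bar> / 2) * (cst 2 * (U * V)) = cst (\<bar>c\<bar> * sgn c) * Poly_Mapping.single m 1"
    by (simp only: U_def V_def uv(3) cst_def mult_single) simp
  also have "\<dots> = Poly_Mapping.single m c"
    by (simp add: cst_def mult_single mult.commute[of "\<bar>c\<bar>"] sgn_mult_abs)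
  finally show ?thesis .
qed

lemma liftable_l1_norm:
  assumes "p \<in> polys_le n (2 * d)"
  shows "liftable n d (l1_norm p) p"
proof -
  have "liftable n d (l1_norm p) (\<Sum>m\<in>Poly_Mapping.keys p. Poly_Mapping.single m (Poly_Mapping.lookup p m))"
    unfolding l1_norm_def using assms
    by (intro liftable_sum liftable_single) (auto simp: polys_le_def)
  also have "(\<Sum>m\<in>Poly_Mapping.keys p. Poly_Mapping.single m (Poly_Mapping.lookup p m)) = p"
    by (intro poly_mapping_eqI) (auto simp: lookup_sum lookup_single when_def in_keys_iff)
  finally show ?thesis .
qed

section \<open>The best approximation\<close>

lemma l1_norm_perturb_le:
  assumes "\<forall>i\<in>{0..n}. 0 \<le> l i"
  shows "l1_norm (f - perturb n d f l) \<le> (\<Sum>i = 0..n. l i)"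
proof -
  have "l1_norm (cst (l i) * hvar i ^ (2 * d)) = l i" if "i \<in> {0..n}" for i
    using assms that by (auto simp: hvar_def cst_def var_power mult_single l1_norm_single)
  then have "(\<Sum>i = 0..n. l1_norm (cst (l i) * hvar i ^ (2 * d))) = (\<Sum>i = 0..n. l i)"
    by (intro sum.cong) auto
  moreover have "f - perturb n d f l = - (\<Sum>i = 0..n. cst (l i) * hvar i ^ (2 * d))"
    by (simp add: perturb_hvar)
  ultimately show ?thesis
    using l1_norm_sum[of "{0..n}" "\<lambda>i. cst (l i) * hvar i ^ (2 * d)"] by (simp add: l1_norm_uminus)
qed

text \<open>
  The step that turns an arbitrary approximant into a perturbation of the special form that is at
  least as good: \<open>f\<close> is \<open>g\<close>, which costs nothing, plus the error \<open>f - g\<close>, which costs at most its norm.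
\<close>

lemma liftable_distance:
  assumes "f \<in> polys_le n (2 * d)" "g \<in> sos n d"
  shows "liftable n d (l1_norm (f - g)) f"
proof -
  have "f - g \<in> polys_le n (2 * d)" using assms by (intro polys_le_diff) (simp_all add: sos_iff)
  from liftable_add[OF liftable_sos[OF assms(2)] liftable_l1_norm[OF this]]
  show ?thesis by simp
qed

lemma tendsto_perturb:
  assumes "\<And>i. i \<in> {0..n} \<Longrightarrow> (\<lambda>k. l k i) \<longlonglongrightarrow> lam i"
  shows "(\<lambda>k. Poly_Mapping.lookup (perturb n d f (l k)) c) \<longlonglongrightarrow> Poly_Mapping.lookup (perturb n d f lam) c"
  unfolding perturb_hvar lookup_add lookup_sum lookup_cst_mult
  by (intro tendsto_add tendsto_const tendsto_sum tendsto_mult_right assms)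

text \<open>
  In a minimizing sequence the weights are nonnegative and have bounded sums, so a subsequence
  converges. Its limit is feasible because the cone is closed.
\<close>

lemma minimal_perturbation_exists:
  assumes "liftable n d r f"
  obtains lam where "\<forall>i\<in>{0..n}. 0 \<le> lam i" "perturb n d f lam \<in> sos n d"
    "\<And>l. \<forall>i\<in>{0..n}. 0 \<le> l i \<Longrightarrow> perturb n d f l \<in> sos n d \<Longrightarrow>
      (\<Sum>i = 0..n. lam i) \<le> (\<Sum>i = 0..n. l i)"
proof -
  define F where "F = {l. (\<forall>i\<in>{0..n}. 0 \<le> l i) \<and> perturb n d f l \<in> sos n d}"
  define S where "S = (\<lambda>l. \<Sum>i = 0..n. l i) ` F"
  have ne: "S \<noteq> {}" using assms by (auto simp: S_def F_def liftable_def)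
  have bdd: "bdd_below S" by (auto simp: S_def F_def intro!: bdd_belowI2[of _ 0] sum_nonneg)
  have "\<exists>l\<in>F. (\<Sum>i = 0..n. l i) < Inf S + 1 / real (Suc k)" for k
    using cInf_lessD[OF ne, of "Inf S + 1 / real (Suc k)"] by (auto simp: S_def)
  then obtain l where l: "\<And>k. l k \<in> F" "\<And>k. (\<Sum>i = 0..n. l k i) < Inf S + 1 / real (Suc k)" by metis
  have nonneg: "0 \<le> l k i" if "i \<in> {0..n}" for k i using l(1)[of k] that by (auto simp: F_def)
  have bounded: "norm (l k i) \<le> Inf S + 1" if "i \<in> {0..n}" for k i
  proof -
    have "l k i \<le> (\<Sum>i = 0..n. l k i)" using that nonneg by (intro member_le_sum) auto
    also have "\<dots> \<le> Inf S + 1 / real (Suc k)" using l(2)[of k] by simp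
    also have "\<dots> \<le> Inf S + 1" by simp
    finally show ?thesis using nonneg[OF that] by simp
  qed
  have "\<forall>i\<in>{0..n}. Bseq (\<lambda>k. l k i)"
    by (intro ballI, rule BseqI'[of _ "Inf S + 1"], rule bounded)
  from common_convergent_subsequence[OF finite_atLeastAtMost this]
  obtain r lam where r: "strict_mono r" and lam: "\<forall>i\<in>{0..n}. (\<lambda>k. l (r k) i) \<longlonglongrightarrow> lam i" by blast
  have lam_nonneg: "\<forall>i\<in>{0..n}. 0 \<le> lam i"
    using lam nonneg by (auto intro: LIMSEQ_le_const)
  have lam_sos: "perturb n d f lam \<in> sos n d"
  proof (rule sos_closed)
    show "perturb n d f (l (r k)) \<in> sos n d" for k using l(1) by (simp add: F_def)
    show "(\<lambda>k. Poly_Mapping.lookup (perturb n d f (l (r k))) c)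
        \<longlonglongrightarrow> Poly_Mapping.lookup (perturb n d f lam) c" for c
      by (rule tendsto_perturb) (use lam in blast)
  qed
  have "(\<Sum>i = 0..n. lam i) \<le> Inf S"
  proof (rule LIMSEQ_le)
    show "(\<lambda>k. \<Sum>i = 0..n. l (r k) i) \<longlonglongrightarrow> (\<Sum>i = 0..n. lam i)" using lam by (intro tendsto_sum) auto
    have "(\<lambda>k. Inf S + 1 / real (Suc k)) \<longlonglongrightarrow> Inf S + 0"
      by (intro tendsto_intros LIMSEQ_Suc lim_1_over_n)
    from LIMSEQ_subseq_LIMSEQ[OF this r]
    show "(\<lambda>k. Inf S + 1 / real (Suc (r k))) \<longlonglongrightarrow> Inf S" by (simp add: o_def)
    show "\<exists>N. \<forall>k\<ge>N. (\<Sum>i = 0..n. l (r k) i) \<le> Inf S + 1 / real (Suc (r k))"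
      using l(2) less_imp_le by blast
  qed
  moreover have "Inf S \<le> (\<Sum>i = 0..n. k i)" if "k \<in> F" for k
    using that bdd by (intro cInf_lower) (auto simp: S_def)
  ultimately show ?thesis using that[OF lam_nonneg lam_sos] by (force simp: F_def)
qed

theorem theorem2p1:
  fixes n d :: nat and f :: real_mpoly
  assumes "f \<in> polys n" and "total_deg f \<le> 2 * d"
  shows "\<exists>lam :: nat \<Rightarrow> real.
    (\<forall>i \<in> {0..n}. 0 \<le> lam i) \<and>
    is_arg_min (\<lambda>g. l1_norm (f - g)) (\<lambda>g. g \<in> sos n d) (perturb n d f lam) \<and>
    rho n d f = (\<Sum>i = 0..n. lam i) \<and>
    is_arg_min (\<lambda>l. \<Sum>i = 0..n. l i)
      (\<lambda>l. (\<forall>i \<in> {0..n}. 0 \<le> l i) \<and> perturb n d f l \<in> sos n d) lam"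
proof -
  have f: "f \<in> polys_le n (2 * d)" using assms by (simp add: polys_le_iff)
  obtain lam where lam: "\<forall>i\<in>{0..n}. 0 \<le> lam i" "perturb n d f lam \<in> sos n d"
    and opt: "\<And>l. \<forall>i\<in>{0..n}. 0 \<le> l i \<Longrightarrow> perturb n d f l \<in> sos n d \<Longrightarrow>
      (\<Sum>i = 0..n. lam i) \<le> (\<Sum>i = 0..n. l i)"
    using minimal_perturbation_exists[OF liftable_l1_norm[OF f]] by blast
  have lower: "(\<Sum>i = 0..n. lam i) \<le> l1_norm (f - g)" if "g \<in> sos n d" for g
    using liftable_distance[OF f that] opt unfolding liftable_def by fastforce
  have dist: "l1_norm (f - perturb n d f lam) = (\<Sum>i = 0..n. lam i)"
    using l1_norm_perturb_le[OF lam(1)] lower[OF lam(2)] by (rule antisym)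
  have "rho n d f = (\<Sum>i = 0..n. lam i)"
    unfolding rho_def by (rule cInf_eq_minimum) (use dist lam(2) lower in \<open>auto simp: image_iff intro!: bexI[of _ "perturb n d f lam"]\<close>)
  moreover have "is_arg_min (\<lambda>g. l1_norm (f - g)) (\<lambda>g. g \<in> sos n d) (perturb n d f lam)"
    using lam(2) lower by (auto simp: is_arg_min_def dist not_less)
  moreover have "is_arg_min (\<lambda>l. \<Sum>i = 0..n. l i)
      (\<lambda>l. (\<forall>i\<in>{0..n}. 0 \<le> l i) \<and> perturb n d f l \<in> sos n d) lam"
    unfolding is_arg_min_def using lam opt leD by blast
  ultimately show ?thesis using lam(1) by blast
qed

end
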